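(* Let $(X,d)$ be a (nonempty) complete metric space, and let $T: X \to X$ be a continuous PA-contraction. Then $T$ has a unique fixed point $x^* \in X$, and for any $x_0 \in X$, the Picard sequence $x_n = T^n x_0$ converges to $x^*$.
   Context: Let $(X,d)$ be a metric space. A mapping $T: X \to X$ is called a PA-contraction (Path-Averaged Contraction) if there exist $\alpha \in (0,1)$ and $N \in \mathbb{N} = \{1,2,3,\dots\}$ such that for all $x, y \in X$ and all integers $n \ge N$, $$\frac{1}{n} \sum_{k=0}^{n-1} d(T^{k+1}x, T^{k+1}y) \leq \alpha \cdot \frac{1}{n} \sum_{k=0}^{n-1} d(T^k x, T^k y).$$ Equivalently, $\sum_{k=0}^{n-1} d(T^{k+1}x, T^{k+1}y) \leq \alpha \sum_{k=0}^{n-1} d(T^k x, T^k y)$. Here $T^k$ denotes the $k$-fold composition of $T$ with itself, and $T^0$ is the identity. The constants $\alpha$ and $N$ do not depend on $x, y$. *)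

theory Defs
  imports "HOL-Analysis.Analysis"
begin

definition PA_contraction :: "('a::metric_space \<Rightarrow> 'a) \<Rightarrow> bool" where
  "PA_contraction T \<longleftrightarrow>
    (\<exists>\<alpha>::real. \<exists>N::nat. 0 < \<alpha> \<and> \<alpha> < 1 \<and> N \<ge> 1 \<and>
      (\<forall>x y. \<forall>n\<ge>N.
        (1 / real n) * (\<Sum>k<n. dist ((T ^^ (k + 1)) x) ((T ^^ (k + 1)) y))
          \<le> \<alpha> * ((1 / real n) * (\<Sum>k<n. dist ((T ^^ k) x) ((T ^^ k) y)))))"

end

theory Submission
  imports Defs
begin

text \<open>
  Let \<open>S n\<close> be the sum of the first \<open>n\<close> distances between the orbits of \<open>x\<close> and \<open>y\<close>. The path-averaged
  condition says \<open>S (n + 1) - dist x y \<le> \<alpha> * S n\<close>, and \<open>S n \<le> S (n + 1)\<close>, so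
  \<open>S n \<le> dist x y / (1 - \<alpha>)\<close>: the distances between any two orbits are summable. Taking \<open>y = T x\<close>
  makes every orbit Cauchy; taking \<open>y\<close> fixed gives convergence to \<open>y\<close>, hence also uniqueness.
\<close>

text \<open>By the triangle inequality, distances along \<open>X\<close> are dominated by distances
  between the partial sums \<open>S\<close>, which converge.\<close>

lemma summable_dist_imp_Cauchy:
  fixes X :: "nat \<Rightarrow> 'a::metric_space"
  assumes "summable (\<lambda>n. dist (X n) (X (Suc n)))"
  shows "Cauchy X"
proof -
  define S where "S n = (\<Sum>k<n. dist (X k) (X (Suc k)))" for n
  have le: "dist (X m) (X n) \<le> S n - S m" if "m \<le> n" for m n
    using that
  proof (induction n rule: dec_induct)
    case (step n)
    then show ?case
      using dist_triangle[of "X m" "X (Suc n)" "X n"] by (simp add: S_def)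
  qed simp
  have dist_le: "dist (X m) (X n) \<le> dist (S m) (S n)" for m n
    using le[of m n] le[of n m] nat_le_linear[of m n] by (auto simp: dist_real_def dist_commute)
  have "Cauchy S"
    using assms unfolding S_def by (simp add: summable_iff_convergent convergent_Cauchy)
  show ?thesis
  proof (rule metric_CauchyI)
    fix e :: real
    assume "0 < e"
    then obtain M where "\<forall>m\<ge>M. \<forall>n\<ge>M. dist (S m) (S n) < e"
      using metric_CauchyD[OF \<open>Cauchy S\<close>] by blast
    then show "\<exists>M. \<forall>m\<ge>M. \<forall>n\<ge>M. dist (X m) (X n) < e"
      using le_less_trans[OF dist_le] by blast
  qed
qed

lemma PA_contraction_summable_dist:
  assumes "PA_contraction T"
  shows "summable (\<lambda>k. dist ((T ^^ k) x) ((T ^^ k) y))"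
proof -
  obtain \<alpha> :: real and N :: nat where \<alpha>: "0 < \<alpha>" "\<alpha> < 1" and N: "N \<ge> 1"
    and contr: "\<And>x y n. n \<ge> N \<Longrightarrow>
        (1 / real n) * (\<Sum>k<n. dist ((T ^^ (k + 1)) x) ((T ^^ (k + 1)) y))
          \<le> \<alpha> * ((1 / real n) * (\<Sum>k<n. dist ((T ^^ k) x) ((T ^^ k) y)))"
    using assms unfolding PA_contraction_def by blast
  define d where "d k = dist ((T ^^ k) x) ((T ^^ k) y)" for k
  have bound: "sum d {..<n} \<le> d 0 / (1 - \<alpha>)" if "n \<ge> N" for n
  proof -
    \<comment> \<open>The factor \<open>1 / real n\<close> cancels because
      \<open>n \<ge> N \<ge> 1\<close>.\<close>
    have "(\<Sum>k<n. d (Suc k)) \<le> \<alpha> * sum d {..<n}"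
      using contr[OF that, of x y] that N by (simp add: d_def field_simps)
    moreover have "sum d {..<Suc n} = d 0 + (\<Sum>k<n. d (Suc k))"
      by (rule sum.lessThan_Suc_shift)
    moreover have "sum d {..<n} \<le> sum d {..<Suc n}"
      by (simp add: d_def)
    ultimately show ?thesis
      using \<alpha> by (simp add: field_simps)
  qed
  have "sum d {..<n} \<le> d 0 / (1 - \<alpha>)" for n
  proof -
    have "sum d {..<n} \<le> sum d {..<max n N}"
      by (rule sum_mono2) (auto simp: d_def)
    also have "\<dots> \<le> d 0 / (1 - \<alpha>)"
      by (rule bound) simp
    finally show ?thesis .
  qed
  then have "summable d"
    by (intro summableI_nonneg_bounded) (simp_all add: d_def)
  then show ?thesis
    by (simp add: d_def[abs_def])
qed

lemma PA_contraction_LIMSEQ_fixpoint: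
  assumes "PA_contraction T" and "T p = p"
  shows "(\<lambda>n. (T ^^ n) x) \<longlonglongrightarrow> p"
proof -
  have "(T ^^ n) p = p" for n
    by (induction n) (simp_all add: assms(2))
  then have "(\<lambda>n. dist ((T ^^ n) x) p) \<longlonglongrightarrow> 0"
    using summable_LIMSEQ_zero[OF PA_contraction_summable_dist[OF assms(1), of x p]] by simp
  then show ?thesis
    by (rule tendsto_dist_iff[THEN iffD2])
qed

lemma PA_contraction_fixpoint_exists:
  fixes T :: "'a::complete_space \<Rightarrow> 'a"
  assumes "continuous_on UNIV T" and "PA_contraction T"
  shows "\<exists>p. T p = p"
proof -
  obtain x :: 'a where True by simp
  define X where "X n = (T ^^ n) x" for n
  have "Cauchy X"
    \<comment> \<open>The orbit of \<open>T x\<close> is the orbit of \<open>x\<close> shifted by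
      one, so these are its consecutive distances.\<close>
    using PA_contraction_summable_dist[OF assms(2), of x "T x"]
    by (intro summable_dist_imp_Cauchy) (simp add: X_def funpow_swap1)
  then obtain p where p: "X \<longlonglongrightarrow> p"
    using Cauchy_convergent convergentD by blast
  \<comment> \<open>Continuity gives the limit \<open>T p\<close>; since
    \<open>T (X n) = X (Suc n)\<close>, the same sequence tends to \<open>p\<close>.\<close>
  have "(\<lambda>n. T (X n)) \<longlonglongrightarrow> T p"
    using continuous_on_tendsto_compose[OF assms(1) p] by simp
  moreover have "(\<lambda>n. T (X n)) \<longlonglongrightarrow> p"
    using LIMSEQ_Suc[OF p] by (simp add: X_def)
  ultimately show ?thesis
    using LIMSEQ_unique by blast
qed

theorem theorem3:
  fixes T :: "'a::complete_space \<Rightarrow> 'a"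
  assumes "continuous_on UNIV T"
    and "PA_contraction T"
  shows "(\<exists>!p. T p = p) \<and> (\<forall>p. T p = p \<longrightarrow> (\<forall>x0. (\<lambda>n. (T ^^ n) x0) \<longlonglongrightarrow> p))"
proof (intro conjI allI impI)
  have lim: "(\<lambda>n. (T ^^ n) x) \<longlonglongrightarrow> p" if "T p = p" for p x
    using PA_contraction_LIMSEQ_fixpoint[OF assms(2) that] .
  obtain p where p: "T p = p"
    using PA_contraction_fixpoint_exists[OF assms] by blast
  \<comment> \<open>The orbit of \<open>p\<close> tends both to \<open>q\<close> and to
    \<open>p\<close>.\<close>
  have "q = p" if "T q = q" for q
    by (rule LIMSEQ_unique[OF lim[OF that, of p] lim[OF p, of p]])
  with p show "\<exists>!p. T p = p"
    by (rule ex1I)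
  show "(\<lambda>n. (T ^^ n) x0) \<longlonglongrightarrow> p" if "T p = p" for p x0
    using that by (rule lim)
qed

end
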